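(* Let $H$ be a Hadamard matrix of order $n\equiv4\pmod8$ having a Hall set. Then the matrix produced from $H$ by switching the Hall set is a Hadamard matrix.
   Context: A Hadamard matrix of order $n$ is an $n\times n$ matrix with entries $\pm1$ whose rows are mutually orthogonal. Let $n\equiv 4\pmod 8$, $n\ge 12$. Four rows of a Hadamard matrix of order $n$ form a Hall set if the entrywise product of the four rows has exactly four entries of one sign and $n-4$ of the other; the four columns carrying those four entries are the Hall columns. By a signed row permutation and a signed column permutation moving the Hall rows and Hall columns to positions $1$–$4$, such a matrix can be put in the form $$\begin{bmatrix} H_4 & F_1 & F_2 & F_3 & F_4\\ G_1 & A_{11}&A_{12}&A_{13}&A_{14}\\ G_2&A_{21}&A_{22}&A_{23}&A_{24}\\ G_3&A_{31}&A_{32}&A_{33}&A_{34}\\ G_4&A_{41}&A_{42}&A_{43}&A_{44}\end{bmatrix},$$ where $H_4$ is the $4\times4$ matrix with $1$ on the diagonal and $-1$ off the diagonal; each $F_i$ is a $4\times\frac{n-4}{4}$ matrix all of whose columns equal $f_i$, with $f_1=(1,1,1,1)^{\mathrm T}$, $f_2=(1,-1,-1,1)^{\mathrm T}$, $f_3=(1,-1,1,-1)^{\mathrm T}$, $f_4=(-1,-1,1,1)^{\mathrm T}$; $G_1=F_1^{\mathrm T}$ and $G_i=-F_i^{\mathrm T}$ for $i=2,3,4$; and each $A_{ij}$ is square of size $\frac{n-4}{4}$, with all row and column sums equal to $2$ if $i=j$ and $0$ if $i\neq j$. Switching the Hall set means: put the matrix in this form by signed permutations, replace $F_i$ by $-F_i$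 and $G_i$ by $-G_i$ for one $i\in\{1,2,3,4\}$, and apply the inverse signed permutations. *)

theory Defs
  imports "Jordan_Normal_Form.Matrix" "HOL-Combinatorics.Permutations"
begin

definition hadamard :: "nat \<Rightarrow> int mat \<Rightarrow> bool" where
  "hadamard n H \<longleftrightarrow> H \<in> carrier_mat n n \<and>
     (\<forall>i<n. \<forall>j<n. H $$ (i, j) \<in> {1, -1}) \<and>
     (\<forall>i<n. \<forall>j<n. i \<noteq> j \<longrightarrow> row H i \<bullet> row H j = 0)"

text \<open>Rows and columns are numbered from 0. For \<open>n \<ge> 12\<close> the set \<open>C\<close> of Hall columns is
  determined by the set \<open>R\<close> of rows, because then \<open>n - 4 \<noteq> 4\<close>.\<close>

definition hall_columns :: "nat \<Rightarrow> int mat \<Rightarrow> nat set \<Rightarrow> nat set \<Rightarrow> bool" where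
  "hall_columns n H R C \<longleftrightarrow> (\<exists>s\<in>{1, -1}.
     C = {j. j < n \<and> (\<Prod>i\<in>R. H $$ (i, j)) = s} \<and> card C = 4 \<and>
     card {j. j < n \<and> (\<Prod>i\<in>R. H $$ (i, j)) = -s} = n - 4)"

definition hall_set :: "nat \<Rightarrow> int mat \<Rightarrow> nat set \<Rightarrow> bool" where
  "hall_set n H R \<longleftrightarrow> R \<subseteq> {..<n} \<and> card R = 4 \<and> (\<exists>C. hall_columns n H R C)"

text \<open>A signed permutation of the indices \<open>{..<n}\<close> is a permutation \<open>p\<close> with a sign function
  \<open>e\<close>. Applied to rows, it puts \<open>e i\<close> times the old row \<open>p i\<close> into position \<open>i\<close>; hence its
  inverse is \<open>inv_into UNIV p\<close> with signs \<open>e \<circ> inv_into UNIV p\<close>.\<close>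

definition signed_perm :: "nat \<Rightarrow> (nat \<Rightarrow> nat) \<Rightarrow> (nat \<Rightarrow> int) \<Rightarrow> bool" where
  "signed_perm n p e \<longleftrightarrow> p permutes {..<n} \<and> (\<forall>i<n. e i \<in> {1, -1})"

definition apply_signed_perms ::
  "nat \<Rightarrow> (nat \<Rightarrow> nat) \<Rightarrow> (nat \<Rightarrow> int) \<Rightarrow> (nat \<Rightarrow> nat) \<Rightarrow> (nat \<Rightarrow> int) \<Rightarrow> int mat \<Rightarrow> int mat" where
  "apply_signed_perms n p e q d M = mat n n (\<lambda>(i, j). e i * d j * M $$ (p i, q j))"

text \<open>The index \<open>i\<close> of \<open>F\<^sub>i\<close>, \<open>G\<^sub>i\<close>, \<open>A\<^sub>i\<^sub>j\<close> runs through \<open>{1..4}\<close>; the \<open>i\<close>-th block of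
  rows (or columns) occupies the \<open>(n - 4) / 4\<close> positions in \<open>hall_block n i\<close>, and the Hall
  rows (columns) occupy the positions \<open>{..<4}\<close>.\<close>

definition hall_block :: "nat \<Rightarrow> nat \<Rightarrow> nat set" where
  "hall_block n i = {4 + (i - 1) * ((n - 4) div 4)..<4 + i * ((n - 4) div 4)}"

definition hall_vec :: "nat \<Rightarrow> int vec" where
  "hall_vec i = vec_of_list
     (if i = 1 then [1, 1, 1, 1]
      else if i = 2 then [1, -1, -1, 1]
      else if i = 3 then [1, -1, 1, -1]
      else [-1, -1, 1, 1])"

text \<open>The conjuncts after the first describe, in this order, \<open>H\<^sub>4\<close>, the \<open>F\<^sub>i\<close>, the \<open>G\<^sub>i\<close>,
  and the row and column sums of the \<open>A\<^sub>i\<^sub>j\<close>.\<close>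

definition hall_form :: "nat \<Rightarrow> int mat \<Rightarrow> bool" where
  "hall_form n N \<longleftrightarrow> N \<in> carrier_mat n n \<and>
     (\<forall>r<4. \<forall>c<4. N $$ (r, c) = (if r = c then 1 else -1)) \<and>
     (\<forall>i\<in>{1..4}. \<forall>r<4. \<forall>c\<in>hall_block n i. N $$ (r, c) = hall_vec i $ r) \<and>
     (\<forall>i\<in>{1..4}. \<forall>r\<in>hall_block n i. \<forall>c<4.
        N $$ (r, c) = (if i = 1 then hall_vec i $ c else - (hall_vec i $ c))) \<and>
     (\<forall>i\<in>{1..4}. \<forall>j\<in>{1..4}.
        (\<forall>r\<in>hall_block n i. (\<Sum>c\<in>hall_block n j. N $$ (r, c)) = (if i = j then 2 else 0)) \<and>
        (\<forall>c\<in>hall_block n j. (\<Sum>r\<in>hall_block n i. N $$ (r, c)) = (if i = j then 2 else 0)))"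

definition switch_form :: "nat \<Rightarrow> nat \<Rightarrow> int mat \<Rightarrow> int mat" where
  "switch_form n i N = mat n n (\<lambda>(r, c).
     if r < 4 \<and> c \<in> hall_block n i \<or> r \<in> hall_block n i \<and> c < 4
     then - N $$ (r, c) else N $$ (r, c))"

text \<open>\<open>hall_switching n H R i H'\<close>: the matrix \<open>H'\<close> can be produced from \<open>H\<close> by switching the Hall
  set \<open>R\<close>, negating \<open>F\<^sub>i\<close> and \<open>G\<^sub>i\<close>. This is a relation since the signed permutations that bring
  \<open>H\<close> into the block form are not unique.\<close>

definition hall_switching :: "nat \<Rightarrow> int mat \<Rightarrow> nat set \<Rightarrow> nat \<Rightarrow> int mat \<Rightarrow> bool" where
  "hall_switching n H R i H' \<longleftrightarrow> (\<exists>C p e q d.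
     hall_columns n H R C \<and>
     signed_perm n p e \<and> signed_perm n q d \<and>
     p ` {..<4} = R \<and> q ` {..<4} = C \<and>
     hall_form n (apply_signed_perms n p e q d H) \<and>
     H' = apply_signed_perms n (inv_into UNIV p) (e \<circ> inv_into UNIV p)
            (inv_into UNIV q) (d \<circ> inv_into UNIV q)
            (switch_form n i (apply_signed_perms n p e q d H)))"

end

theory Submission
  imports Defs "Jordan_Normal_Form.Determinant"
begin

text \<open>Orthogonality to the four Hall rows determines the block sums of any row from its entries in
  the Hall columns, since the Gram matrix of the \<open>f\<^sub>i\<close> is \<open>4I\<close>; the same holds for columns. Hence
  the border of a Hadamard matrix in block form forces the row and column sums of the \<open>A\<^sub>i\<^sub>j\<close>, and
  these are exactly what makes switching preserve orthogonality.

  For the existence of the block form, classify columns up to sign by their entries in the Hall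
  rows. Orthogonality of the Hall rows gives linear equations for the numbers of columns of each of
  the eight types, with a unique solution. For rows one first needs that a non-Hall row
  has an even number of negative entries in the Hall columns: its sum over the first block is half
  of the sum of these four entries, and it is even because the block length \<open>(n - 4) / 4\<close> is even,
  which is where \<open>n mod 8 = 4\<close> enters.\<close>

subsection \<open>Hadamard matrices\<close>

lemma hadamard_iff_sum:
  "hadamard n H \<longleftrightarrow> H \<in> carrier_mat n n \<and>
     (\<forall>i<n. \<forall>j<n. H $$ (i, j) \<in> {1, -1}) \<and>
     (\<forall>i<n. \<forall>j<n. i \<noteq> j \<longrightarrow> (\<Sum>k<n. H $$ (i, k) * H $$ (j, k)) = 0)"
proof -
  have "row H i \<bullet> row H j = (\<Sum>k<n. H $$ (i, k) * H $$ (j, k))"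
    if "H \<in> carrier_mat n n" "i < n" "j < n" for i j
    using that by (simp add: scalar_prod_def atLeast0LessThan)
  then show ?thesis
    unfolding hadamard_def by (auto 0 4)
qed

text \<open>Row orthogonality says \<open>H * H^T = n I\<close>, and a one-sided inverse of a square
  matrix is two-sided, so \<open>H^T * H = n I\<close>. The computation takes place over the
  rationals in order to divide by \<open>n\<close>.\<close>

lemma hadamard_columns_orthogonal:
  assumes H: "hadamard n H" and ij: "i < n" "j < n" "i \<noteq> j"
  shows "(\<Sum>k<n. H $$ (k, i) * H $$ (k, j)) = 0"
proof -
  have car: "H \<in> carrier_mat n n"
    and pm: "\<And>i j. i < n \<Longrightarrow> j < n \<Longrightarrow> H $$ (i, j) * H $$ (i, j) = 1"
    and orth: "\<And>i j. i < n \<Longrightarrow> j < n \<Longrightarrow> i \<noteq> j \<Longrightarrow> (\<Sum>k<n. H $$ (i, k) * H $$ (j, k)) = 0"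
    using H unfolding hadamard_iff_sum by fastforce+
  define A :: "rat mat" where "A = map_mat of_int H"
  define B :: "rat mat" where "B = (1 / of_nat n) \<cdot>\<^sub>m transpose_mat A"
  have A: "A \<in> carrier_mat n n" and B: "B \<in> carrier_mat n n"
    using car by (auto simp: A_def B_def)
  have "(A * B) $$ (r, c) = (if r = c then 1 else 0)" if "r < n" "c < n" for r c
  proof -
    have "(A * B) $$ (r, c) = (\<Sum>k<n. of_int (H $$ (r, k)) * (of_int (H $$ (c, k)) / of_nat n))"
      using that car by (simp add: A_def B_def scalar_prod_def atLeast0LessThan)
    also have "\<dots> = of_int (\<Sum>k<n. H $$ (r, k) * H $$ (c, k)) / of_nat n"
      by (simp add: sum_divide_distrib)
    also have "(\<Sum>k<n. H $$ (r, k) * H $$ (c, k)) = (if r = c then int n else 0)"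
      using that by (simp add: pm orth)
    finally show ?thesis using that by simp
  qed
  then have "A * B = 1\<^sub>m n"
    using A B by (intro eq_matI) auto
  then have "B * A = 1\<^sub>m n"
    using mat_mult_left_right_inverse[OF A B] by simp
  then have "(B * A) $$ (i, j) = 0" using ij by simp
  moreover have "(B * A) $$ (i, j) = of_int (\<Sum>k<n. H $$ (k, i) * H $$ (k, j)) / of_nat n"
    using ij car by (simp add: A_def B_def scalar_prod_def atLeast0LessThan sum_divide_distrib)
  ultimately have "(of_int (\<Sum>k<n. H $$ (k, i) * H $$ (k, j)) :: rat) = 0"
    using ij by simp
  then show ?thesis by linarith
qed

lemma signed_perm_inv:
  assumes "signed_perm n p e"
  shows "signed_perm n (inv_into UNIV p) (e \<circ> inv_into UNIV p)"
proof -
  have "inv_into UNIV p permutes {..<n}"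
    using assms permutes_inv unfolding signed_perm_def by blast
  moreover from this have "inv_into UNIV p i < n" if "i < n" for i
    using that permutes_in_image[of "inv_into UNIV p" "{..<n}" i] by simp
  ultimately show ?thesis
    using assms by (simp add: signed_perm_def)
qed

lemma hadamard_apply_signed_perms:
  assumes p: "signed_perm n p e" and q: "signed_perm n q d" and M: "hadamard n M"
  shows "hadamard n (apply_signed_perms n p e q d M)"
proof -
  have pm: "M $$ (i, j) \<in> {1, -1}" if "i < n" "j < n" for i j
    using M that unfolding hadamard_iff_sum by blast
  have orth: "(\<Sum>k<n. M $$ (i, k) * M $$ (j, k)) = 0" if "i < n" "j < n" "i \<noteq> j" for i j
    using M that unfolding hadamard_iff_sum by blast
  have e: "e i = 1 \<or> e i = -1" and d: "d i = 1 \<or> d i = -1" if "i < n" for i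
    using p q that unfolding signed_perm_def by auto
  have pp: "p permutes {..<n}" and qp: "q permutes {..<n}"
    using p q by (auto simp: signed_perm_def)
  have pn: "p i < n" and qn: "q i < n" if "i < n" for i
    using that permutes_in_image[OF pp] permutes_in_image[OF qp] by auto
  let ?N = "apply_signed_perms n p e q d M"
  have N: "?N $$ (i, j) = e i * d j * M $$ (p i, q j)" if "i < n" "j < n" for i j
    using that by (simp add: apply_signed_perms_def)
  have "(\<Sum>k<n. ?N $$ (i, k) * ?N $$ (j, k)) = 0" if ij: "i < n" "j < n" "i \<noteq> j" for i j
  proof -
    \<comment> \<open>The column signs square to 1, the row signs are constant in the sum, and
      \<open>q\<close> only reorders the summands.\<close>
    have "(\<Sum>k<n. ?N $$ (i, k) * ?N $$ (j, k)) =
        (\<Sum>k<n. e i * e j * (M $$ (p i, q k) * M $$ (p j, q k)))"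
      using ij d by (intro sum.cong) (force simp: N)+
    also have "\<dots> = e i * e j * (\<Sum>k<n. M $$ (p i, q k) * M $$ (p j, q k))"
      by (simp add: sum_distrib_left)
    also have "(\<Sum>k<n. M $$ (p i, q k) * M $$ (p j, q k)) = (\<Sum>k<n. M $$ (p i, k) * M $$ (p j, k))"
      using sum.permute[OF qp, of "\<lambda>k. M $$ (p i, k) * M $$ (p j, k)"] by (simp add: o_def)
    also have "\<dots> = 0"
      using ij pn permutes_inj[OF pp] by (intro orth) (auto dest: injD)
    finally show ?thesis by simp
  qed
  moreover have "?N $$ (i, j) \<in> {1, -1}" if "i < n" "j < n" for i j
    using pm[OF pn[OF that(1)] qn[OF that(2)]] e[OF that(1)] d[OF that(2)] by (auto simp: N that)
  ultimately show ?thesis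
    unfolding hadamard_iff_sum by (auto simp: apply_signed_perms_def)
qed

subsection \<open>Positions, types and blocks\<close>

lemma less_4_cases: "(r::nat) < 4 \<Longrightarrow> r = 0 \<or> r = 1 \<or> r = 2 \<or> r = 3"
  by presburger

lemma all_less_4: "(\<forall>r<4. P (r::nat)) \<longleftrightarrow> P 0 \<and> P 1 \<and> P 2 \<and> P 3"
  by (auto dest!: less_4_cases)

lemma sum_less_4: "(\<Sum>r<4. f (r::nat)) = f 0 + f 1 + f 2 + (f 3 :: int)"
  by (simp add: eval_nat_numeral)

lemma hall_vec_index:
  "hall_vec 1 $ 0 = 1" "hall_vec 1 $ 1 = 1" "hall_vec 1 $ 2 = 1" "hall_vec 1 $ 3 = 1"
  "hall_vec 2 $ 0 = 1" "hall_vec 2 $ 1 = -1" "hall_vec 2 $ 2 = -1" "hall_vec 2 $ 3 = 1"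
  "hall_vec 3 $ 0 = 1" "hall_vec 3 $ 1 = -1" "hall_vec 3 $ 2 = 1" "hall_vec 3 $ 3 = -1"
  "hall_vec 4 $ 0 = -1" "hall_vec 4 $ 1 = -1" "hall_vec 4 $ 2 = 1" "hall_vec 4 $ 3 = 1"
  unfolding hall_vec_def vec_of_list_index by simp_all

lemma sum_hall_blocks:
  fixes f :: "nat \<Rightarrow> int"
  assumes "n mod 8 = 4"
  shows "(\<Sum>j<n. f j) = f 0 + f 1 + f 2 + f 3 + sum f (hall_block n 1) + sum f (hall_block n 2)
    + sum f (hall_block n 3) + sum f (hall_block n 4)"
proof -
  define m where "m = (n - 4) div 4"
  \<comment> \<open>The congruence forces \<open>n \<ge> 4\<close>, so the truncated subtraction
    loses nothing and the division is exact.\<close>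
  have n: "n = 4 + 4 * m" using assms unfolding m_def by presburger
  have "(\<Sum>j<n. f j) = sum f {0..<4} + sum f {4..<4+m} + sum f {4+m..<4+2*m}
    + sum f {4+2*m..<4+3*m} + sum f {4+3*m..<4+4*m}"
    by (simp add: sum.atLeastLessThan_concat n lessThan_atLeast0)
  then show ?thesis
    by (simp add: hall_block_def m_def[symmetric] sum_less_4[unfolded lessThan_atLeast0])
qed

text \<open>Types \<open>0\<close> to \<open>3\<close> are the four Hall positions; type \<open>3 + i\<close> is the \<open>i\<close>-th block.\<close>

definition hall_type :: "nat \<Rightarrow> nat \<Rightarrow> nat" where
  "hall_type n j = (if j < 4 then j else 4 + (j - 4) div ((n - 4) div 4))"

lemma card_hall_block: "card (hall_block n i) = (if i = 0 then 0 else (n - 4) div 4)"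
  by (cases i) (auto simp: hall_block_def)

lemma hall_type_eq_iff:
  assumes "n \<ge> 12" "i \<in> {1..4}"
  shows "hall_type n j = 3 + i \<longleftrightarrow> j \<in> hall_block n i"
proof -
  define m where "m = (n - 4) div 4"
  \<comment> \<open>With \<open>m = 0\<close>, division would send every position outside the Hall
    positions to type 4.\<close>
  have m: "m > 0" using assms unfolding m_def by presburger
  obtain k where k: "i = Suc k" using assms by (cases i) auto
  have "(j - 4) div m = k \<longleftrightarrow> k * m \<le> j - 4 \<and> j - 4 < Suc k * m"
    using dividend_less_div_times[OF m, of "j - 4"] div_nat_eqI[of m k "j - 4"]
      div_times_less_eq_dividend[of "j - 4" m]
    by (auto simp: algebra_simps)
  moreover have "k * m \<le> j - 4 \<longleftrightarrow> 4 + k * m \<le> j" if "4 \<le> j"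
    using that by linarith
  ultimately show ?thesis
    unfolding hall_type_def hall_block_def k m_def[symmetric] by (cases "j < 4") auto
qed

lemma hall_block_bounds:
  assumes "n mod 8 = 4" "i \<in> {1..4}" "j \<in> hall_block n i"
  shows "4 \<le> j" "j < n"
proof -
  define m where "m = (n - 4) div 4"
  have n: "n = 4 + 4 * m" using assms unfolding m_def by presburger
  have "i * m \<le> 4 * m" using assms by (intro mult_right_mono) auto
  moreover have "4 + (i - 1) * m \<le> j" "j < 4 + i * m"
    using assms(3) by (simp_all add: hall_block_def m_def)
  ultimately show "4 \<le> j" "j < n" unfolding n by linarith+
qed

lemma hall_type_less_8:
  assumes "n mod 8 = 4" "j < n"
  shows "hall_type n j < 8"
proof -
  define m where "m = (n - 4) div 4"
  have n: "n = 4 + 4 * m" using assms unfolding m_def by presburger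
  have "(j - 4) div m < 4" if "4 \<le> j"
    using assms(2) that n by (intro less_mult_imp_div_less) linarith
  then show ?thesis
    by (simp add: hall_type_def m_def[symmetric])
qed

lemma hall_block_exhaust:
  assumes "n mod 8 = 4" "n \<ge> 12" "j < n"
  obtains "j < 4" | i where "i \<in> {1..4}" "j \<in> hall_block n i"
proof (cases "j < 4")
  case False
  then have "hall_type n j \<ge> 4" by (simp add: hall_type_def)
  then have "hall_type n j = 3 + (hall_type n j - 3)" "hall_type n j - 3 \<in> {1..4}"
    using hall_type_less_8[OF assms(1,3)] by auto
  then show ?thesis using that(2) hall_type_eq_iff[OF assms(2)] by blast
qed

text \<open>The simplifier rewrites the numeral \<open>1\<close> to \<open>Suc 0\<close>, so the
  index rules are kept in both shapes.\<close>

lemmas hall_vec_simps = hall_vec_index hall_vec_index[unfolded One_nat_def]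

text \<open>\<open>type_vec t\<close> is the part in the Hall rows of a column of type \<open>t\<close> in block form. Up to the
  factor \<open>type_sign t\<close>, it is also the part in the Hall columns of a row of type \<open>t\<close>, because \<open>H\<^sub>4\<close>
  is symmetric.\<close>

definition type_vec :: "nat \<Rightarrow> nat \<Rightarrow> int" where
  "type_vec t r = (if t < 4 then if r = t then 1 else -1 else hall_vec (t - 3) $ r)"

definition type_sign :: "nat \<Rightarrow> int" where
  "type_sign t = (if t \<le> 4 then 1 else -1)"

lemma less_8_cases: "(t::nat) < 8 \<Longrightarrow> t = 0 \<or> t = 1 \<or> t = 2 \<or> t = 3 \<or> t = 4 \<or> t = 5 \<or> t = 6 \<or> t = 7"
  by presburger

lemma sum_less_8: "(\<Sum>t<8. f (t::nat)) = f 0 + f 1 + f 2 + f 3 + f 4 + f 5 + f 6 + (f 7 :: int)"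
  by (simp add: eval_nat_numeral)

lemma ex_less_8: "(\<exists>t<8. P (t::nat)) \<longleftrightarrow> P 0 \<or> P 1 \<or> P 2 \<or> P 3 \<or> P 4 \<or> P 5 \<or> P 6 \<or> P 7"
proof -
  have "{..<8::nat} = {0, 1, 2, 3, 4, 5, 6, 7}"
    by (auto dest!: less_8_cases)
  then have "(\<exists>t\<in>{..<8}. P t) \<longleftrightarrow> (\<exists>t\<in>{0, 1, 2, 3, 4, 5, 6, 7}. P t)"
    by simp
  then show ?thesis by auto
qed

lemma atLeast1_atMost_4: "{1..4::nat} = {1, 2, 3, 4}"
  by auto

lemma type_vec_orthogonal:
  assumes "k \<in> {1..4}" "l \<in> {1..4}"
  shows "(\<Sum>r<4. type_vec (3 + k) r * type_vec (3 + l) r) = (if k = l then 4 else 0)"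
  using assms unfolding atLeast1_atMost_4
  by (auto simp: type_vec_def sum_less_4 hall_vec_simps)

subsection \<open>Row and column sums of the blocks\<close>

text \<open>Adding the four equations with weights \<open>type_vec (3 + k)\<close> isolates four
  times the sum over block \<open>k\<close>. The Hall positions enter through
  \<open>H_4 = 2 I - J\<close>, which has eigenvalue -2 on \<open>f_1\<close> and 2 on the other
  \<open>f_k\<close>; this is where \<open>type_sign\<close> comes from. The vector \<open>y\<close>
  is arbitrary so that rows, signed columns and rows not yet arranged can all be inserted.\<close>

lemma hall_block_sum_solution:
  assumes n: "n mod 8 = 4" "n \<ge> 12" and k: "k \<in> {1..4}"
    and orth: "\<And>r. r < 4 \<Longrightarrow> (\<Sum>j<n. type_vec (hall_type n j) r * y j) = 0"
  shows "2 * sum y (hall_block n k) = type_sign (3 + k) * (\<Sum>r<4. type_vec (3 + k) r * y r)"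
proof -
  have block: "(\<Sum>j\<in>hall_block n l. type_vec (hall_type n j) r * y j)
      = type_vec (3 + l) r * sum y (hall_block n l)" if "l \<in> {1..4}" for l r
    unfolding sum_distrib_left using hall_type_eq_iff[OF n(2) that]
    by (intro sum.cong refl) metis
  have blocks: "(\<Sum>j\<in>hall_block n 1. type_vec (hall_type n j) r * y j) = type_vec 4 r * sum y (hall_block n 1)"
    "(\<Sum>j\<in>hall_block n 2. type_vec (hall_type n j) r * y j) = type_vec 5 r * sum y (hall_block n 2)"
    "(\<Sum>j\<in>hall_block n 3. type_vec (hall_type n j) r * y j) = type_vec 6 r * sum y (hall_block n 3)"
    "(\<Sum>j\<in>hall_block n 4. type_vec (hall_type n j) r * y j) = type_vec 7 r * sum y (hall_block n 4)" for r
    using block[of 1] block[of 2] block[of 3] block[of 4] by auto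
  have type: "hall_type n 0 = 0" "hall_type n 1 = 1" "hall_type n 2 = 2" "hall_type n 3 = 3"
    by (simp_all add: hall_type_def)
  have eq: "type_vec 0 r * y 0 + type_vec 1 r * y 1 + type_vec 2 r * y 2 + type_vec 3 r * y 3
      + type_vec 4 r * sum y (hall_block n 1) + type_vec 5 r * sum y (hall_block n 2)
      + type_vec 6 r * sum y (hall_block n 3) + type_vec 7 r * sum y (hall_block n 4) = 0"
    if "r < 4" for r
    using orth[OF that] unfolding sum_hall_blocks[OF n(1)] blocks type .
  show ?thesis
    using k eq[of 0] eq[of 1] eq[of 2] eq[of 3] unfolding atLeast1_atMost_4
    by (auto simp: type_vec_def type_sign_def sum_less_4 hall_vec_simps)
qed

text \<open>The entries that \<open>hall_form\<close> prescribes, separated from the block sums,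
  which follow from them in a Hadamard matrix.\<close>

definition hall_border :: "nat \<Rightarrow> int mat \<Rightarrow> bool" where
  "hall_border n N \<longleftrightarrow>
     (\<forall>r<4. \<forall>c<n. N $$ (r, c) = type_vec (hall_type n c) r) \<and>
     (\<forall>r<n. \<forall>c<4. N $$ (r, c) = type_sign (hall_type n r) * type_vec (hall_type n r) c)"

lemma type_sign_square: "type_sign t * type_sign t = 1"
  by (simp add: type_sign_def)

text \<open>A row in a block is orthogonal to the Hall rows, so
  \<open>hall_block_sum_solution\<close> applies; its right-hand side becomes, up to sign, the inner
  product of two block vectors. Columns are treated alike, using column orthogonality.\<close>

lemma hall_border_block_sums:
  assumes n: "n mod 8 = 4" "n \<ge> 12" and N: "hadamard n N" "hall_border n N"
    and ij: "i \<in> {1..4}" "j \<in> {1..4}"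
  shows "r \<in> hall_block n i \<Longrightarrow> (\<Sum>c\<in>hall_block n j. N $$ (r, c)) = (if i = j then 2 else 0)"
    and "c \<in> hall_block n j \<Longrightarrow> (\<Sum>r\<in>hall_block n i. N $$ (r, c)) = (if i = j then 2 else 0)"
proof -
  have top: "N $$ (r, c) = type_vec (hall_type n c) r" if "r < 4" "c < n" for r c
    using N(2) that unfolding hall_border_def by blast
  have left: "N $$ (r, c) = type_sign (hall_type n r) * type_vec (hall_type n r) c"
    if "r < n" "c < 4" for r c
    using N(2) that unfolding hall_border_def by blast
  {
    assume r: "r \<in> hall_block n i"
    have rn: "4 \<le> r" "r < n" using hall_block_bounds[OF n(1) ij(1) r] by auto
    have "(\<Sum>k<n. type_vec (hall_type n k) s * N $$ (r, k)) = 0" if "s < 4" for s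
    proof -
      have "(\<Sum>k<n. type_vec (hall_type n k) s * N $$ (r, k)) = (\<Sum>k<n. N $$ (s, k) * N $$ (r, k))"
        using that top by simp
      also have "\<dots> = 0"
        using N(1) rn that unfolding hadamard_iff_sum by auto
      finally show ?thesis .
    qed
    from hall_block_sum_solution[OF n ij(2) this]
    have "2 * (\<Sum>c\<in>hall_block n j. N $$ (r, c))
      = type_sign (3 + j) * (\<Sum>c<4. type_vec (3 + j) c * (type_sign (3 + i) * type_vec (3 + i) c))"
      using left[OF rn(2)] hall_type_eq_iff[OF n(2) ij(1), of r] r by simp
    also have "\<dots> = type_sign (3 + j) * type_sign (3 + i) * (\<Sum>c<4. type_vec (3 + j) c * type_vec (3 + i) c)"
      by (simp add: sum_distrib_left mult_ac)
    finally show "(\<Sum>c\<in>hall_block n j. N $$ (r, c)) = (if i = j then 2 else 0)"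
      unfolding type_vec_orthogonal[OF ij(2,1)] by (auto simp: type_sign_square split: if_splits)
  }
  {
    assume c: "c \<in> hall_block n j"
    have cn: "4 \<le> c" "c < n" using hall_block_bounds[OF n(1) ij(2) c] by auto
    \<comment> \<open>These signs cancel those of the left border, so the weighted column satisfies
      the same linear system as a row.\<close>
    let ?y = "\<lambda>r. type_sign (hall_type n r) * N $$ (r, c)"
    have "(\<Sum>k<n. type_vec (hall_type n k) s * ?y k) = 0" if "s < 4" for s
    proof -
      have "(\<Sum>k<n. type_vec (hall_type n k) s * ?y k) = (\<Sum>k<n. N $$ (k, s) * N $$ (k, c))"
        using that left by (simp add: mult_ac)
      also have "\<dots> = 0"
        using hadamard_columns_orthogonal[OF N(1)] cn that by auto
      finally show ?thesis .
    qed
    from hall_block_sum_solution[OF n ij(1) this]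
    have "2 * sum ?y (hall_block n i) = type_sign (3 + i) * (\<Sum>r<4. type_vec (3 + i) r * ?y r)" .
    moreover have "sum ?y (hall_block n i) = type_sign (3 + i) * (\<Sum>r\<in>hall_block n i. N $$ (r, c))"
      unfolding sum_distrib_left using hall_type_eq_iff[OF n(2) ij(1)]
      by (intro sum.cong refl) metis
    moreover have "(\<Sum>r<4. type_vec (3 + i) r * ?y r) = (\<Sum>r<4. type_vec (3 + i) r * type_vec (3 + j) r)"
      using top[OF _ cn(2)] hall_type_eq_iff[OF n(2) ij(2), of c] c
      by (intro sum.cong) (auto simp: hall_type_def[of n "_ :: nat"] type_sign_def)
    ultimately show "(\<Sum>r\<in>hall_block n i. N $$ (r, c)) = (if i = j then 2 else 0)"
      unfolding type_vec_orthogonal[OF ij] by (auto simp: type_sign_def split: if_splits)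
  }
qed

lemma hall_border_imp_hall_form:
  assumes n: "n mod 8 = 4" "n \<ge> 12" and N: "hadamard n N" "hall_border n N"
  shows "hall_form n N"
proof -
  have top: "N $$ (r, c) = type_vec (hall_type n c) r" if "r < 4" "c < n" for r c
    using N(2) that unfolding hall_border_def by blast
  have left: "N $$ (r, c) = type_sign (hall_type n r) * type_vec (hall_type n r) c"
    if "r < n" "c < 4" for r c
    using N(2) that unfolding hall_border_def by blast
  have "N $$ (r, c) = (if r = c then 1 else -1)" if "r < 4" "c < 4" for r c
    using top[of r c] that n(2) by (simp add: hall_type_def type_vec_def)
  moreover have "N $$ (r, c) = hall_vec i $ r" if "i \<in> {1..4}" "r < 4" "c \<in> hall_block n i" for i r c
    using top[of r c] that hall_block_bounds[OF n(1) that(1,3)] hall_type_eq_iff[OF n(2) that(1), of c]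
    by (simp add: type_vec_def)
  moreover have "N $$ (r, c) = (if i = 1 then hall_vec i $ c else - (hall_vec i $ c))"
    if "i \<in> {1..4}" "r \<in> hall_block n i" "c < 4" for i r c
    using left[of r c] that hall_block_bounds[OF n(1) that(1,2)] hall_type_eq_iff[OF n(2) that(1), of r]
    by (simp add: type_vec_def type_sign_def)
  moreover have "N \<in> carrier_mat n n"
    using N(1) by (simp add: hadamard_def)
  ultimately show ?thesis
    unfolding hall_form_def using hall_border_block_sums[OF n N] by simp
qed

subsection \<open>Switching in block form\<close>

lemma hall_form_imp_hall_border:
  assumes n: "n mod 8 = 4" "n \<ge> 12" and N: "hall_form n N"
  shows "hall_border n N"
proof -
  have H4: "N $$ (r, c) = (if r = c then 1 else -1)" if "r < 4" "c < 4" for r c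
    using N that unfolding hall_form_def by blast
  have F: "N $$ (r, c) = hall_vec i $ r" if "i \<in> {1..4}" "r < 4" "c \<in> hall_block n i" for i r c
    using N that unfolding hall_form_def by blast
  have G: "N $$ (r, c) = (if i = 1 then hall_vec i $ c else - (hall_vec i $ c))"
    if "i \<in> {1..4}" "r \<in> hall_block n i" "c < 4" for i r c
    using N that unfolding hall_form_def by blast
  have "N $$ (r, c) = type_vec (hall_type n c) r" if "r < 4" "c < n" for r c
    using n(1) n(2) \<open>c < n\<close>
  proof (cases rule: hall_block_exhaust)
    case 1
    then show ?thesis using H4 that by (simp add: hall_type_def type_vec_def)
  next
    case (2 i)
    then show ?thesis using F that hall_type_eq_iff[OF n(2) 2(1), of c] by (simp add: type_vec_def)
  qed
  moreover have "N $$ (r, c) = type_sign (hall_type n r) * type_vec (hall_type n r) c" if "r < n" "c < 4" for r c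
    using n(1) n(2) \<open>r < n\<close>
  proof (cases rule: hall_block_exhaust)
    case 1
    then show ?thesis using H4 that by (simp add: hall_type_def type_vec_def type_sign_def)
  next
    case (2 i)
    then show ?thesis using G that hall_type_eq_iff[OF n(2) 2(1), of r] by (simp add: type_vec_def type_sign_def)
  qed
  ultimately show ?thesis unfolding hall_border_def by blast
qed

text \<open>Switching changes the inner product of two rows only by negating parts of it. In each
  case either everything that is nonzero changes sign together, or the negated part sums to
  0.\<close>

lemma hadamard_switch_form:
  assumes n: "n mod 8 = 4" "n \<ge> 12" and i: "i \<in> {1..4}"
    and N: "hadamard n N" "hall_form n N"
  shows "hadamard n (switch_form n i N)"
proof -
  have top: "N $$ (r, c) = type_vec (hall_type n c) r" if "r < 4" "c < n" for r c
    using hall_form_imp_hall_border[OF n N(2)] that unfolding hall_border_def by blast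
  have left: "N $$ (r, c) = type_sign (hall_type n r) * type_vec (hall_type n r) c"
    if "r < n" "c < 4" for r c
    using hall_form_imp_hall_border[OF n N(2)] that unfolding hall_border_def by blast
  have block_sum: "(\<Sum>c\<in>hall_block n k. N $$ (r, c)) = (if l = k then 2 else 0)"
    if "l \<in> {1..4}" "k \<in> {1..4}" "r \<in> hall_block n l" for r k l
    using N(2) that unfolding hall_form_def by blast
  have orth: "(\<Sum>k<n. N $$ (a, k) * N $$ (b, k)) = 0" if "a < n" "b < n" "a \<noteq> b" for a b
    using N(1) that unfolding hadamard_iff_sum by blast
  let ?M = "switch_form n i N"
  have M: "?M $$ (r, c) = (if r < 4 \<and> c \<in> hall_block n i \<or> r \<in> hall_block n i \<and> c < 4
     then - N $$ (r, c) else N $$ (r, c))" if "r < n" "c < n" for r c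
    using that by (simp add: switch_form_def)
  have ge4: "4 \<le> c" "c < n" if "c \<in> hall_block n k" "k \<in> {1..4}" for c k
    using hall_block_bounds[OF n(1)] that by auto
  have disj: "k = l" if "c \<in> hall_block n k" "c \<in> hall_block n l" "k \<in> {1..4}" "l \<in> {1..4}" for c k l
    using hall_type_eq_iff[OF n(2)] that by (metis add_left_cancel)
  \<comment> \<open>Let \<open>b\<close> lie in block \<open>l\<close>. The products over the
    columns of block \<open>l\<close> sum to \<open>2 * type_vec (3 + l) a\<close>, those over the
    Hall columns cancel this, and every other block gives 0. For \<open>l = i\<close> both nonzero
    parts change sign; otherwise only the zero contribution of block \<open>i\<close> does.\<close>
  have mixed: "(\<Sum>k<n. ?M $$ (a, k) * ?M $$ (b, k)) = 0" if ab: "a < 4" "4 \<le> b" "b < n" for a b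
  proof -
    obtain l where l: "l \<in> {1..4}" "b \<in> hall_block n l"
      using hall_block_exhaust[OF n ab(3)] ab(2) by (metis leD)
    let ?P = "\<lambda>f. f 0 + f 1 + f 2 + f (3::nat) :: int"
    have iff: "b \<in> hall_block n i \<longleftrightarrow> l = i"
      using l i disj by blast
    have Q: "(\<Sum>c\<in>hall_block n k. N $$ (a, c) * N $$ (b, c)) = (if k = l then 2 * type_vec (3 + k) a else 0)"
      if "k \<in> {1..4}" for k
    proof -
      have "(\<Sum>c\<in>hall_block n k. N $$ (a, c) * N $$ (b, c))
          = type_vec (3 + k) a * (\<Sum>c\<in>hall_block n k. N $$ (b, c))"
        unfolding sum_distrib_left
      proof (intro sum.cong refl)
        fix c assume c: "c \<in> hall_block n k"
        then have "hall_type n c = 3 + k" using hall_type_eq_iff[OF n(2) that] by blast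
        then show "N $$ (a, c) * N $$ (b, c) = type_vec (3 + k) a * N $$ (b, c)"
          using top[of a c] ab(1) ge4[OF c that] by simp
      qed
      then show ?thesis using block_sum[OF l(1) that l(2)] by auto
    qed
    have MQ: "(\<Sum>c\<in>hall_block n k. ?M $$ (a, c) * ?M $$ (b, c))
        = (if k = i then -1 else 1) * (if k = l then 2 * type_vec (3 + k) a else 0)"
      if "k \<in> {1..4}" for k
    proof -
      have "(\<Sum>c\<in>hall_block n k. ?M $$ (a, c) * ?M $$ (b, c))
          = (\<Sum>c\<in>hall_block n k. (if k = i then -1 else 1) * (N $$ (a, c) * N $$ (b, c)))"
      proof (intro sum.cong refl)
        fix c assume c: "c \<in> hall_block n k"
        then have "c \<in> hall_block n i \<longleftrightarrow> k = i" using disj that i by blast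
        then show "?M $$ (a, c) * ?M $$ (b, c) = (if k = i then -1 else 1) * (N $$ (a, c) * N $$ (b, c))"
          using ge4[OF c that] ab M[of a c] M[of b c] by auto
      qed
      then show ?thesis unfolding sum_distrib_left[symmetric] Q[OF that] .
    qed
    have MP: "?M $$ (a, c) * ?M $$ (b, c) = (if l = i then -1 else 1) * (N $$ (a, c) * N $$ (b, c))"
      if "c < 4" for c
    proof -
      have "c \<notin> hall_block n i" "a \<notin> hall_block n i"
        using ge4(1)[OF _ i] that ab(1) by (meson leD)+
      then show ?thesis using M[of a c] M[of b c] that ab iff by auto
    qed
    have "?P (\<lambda>c. N $$ (a, c) * N $$ (b, c)) + 2 * type_vec (3 + l) a = 0"
      using orth[of a b] ab l(1) Q[of 1] Q[of 2] Q[of 3] Q[of 4]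
      unfolding sum_hall_blocks[OF n(1)] atLeast1_atMost_4 by auto
    then show ?thesis
      using l(1) MP[of 0] MP[of 1] MP[of 2] MP[of 3] MQ[of 1] MQ[of 2] MQ[of 3] MQ[of 4]
      unfolding sum_hall_blocks[OF n(1)] atLeast1_atMost_4 by auto
  qed
  have "(\<Sum>k<n. ?M $$ (a, k) * ?M $$ (b, k)) = 0" if ab: "a < n" "b < n" "a \<noteq> b" for a b
  proof -
    consider "a < 4" "b < 4" | "a < 4" "4 \<le> b" | "4 \<le> a" "b < 4" | "4 \<le> a" "4 \<le> b"
      by linarith
    then show ?thesis
    proof cases
      \<comment> \<open>Both Hall rows are negated in the same columns.\<close>
      case 1
      then have "a \<notin> hall_block n i" "b \<notin> hall_block n i" using ge4(1)[OF _ i] by (meson leD)+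
      then have "(\<Sum>k<n. ?M $$ (a, k) * ?M $$ (b, k)) = (\<Sum>k<n. N $$ (a, k) * N $$ (b, k))"
        using ab 1 by (intro sum.cong) (simp_all add: M)
      then show ?thesis using orth[OF ab] by simp
    next
      case 2
      then show ?thesis using mixed ab by blast
    next
      case 3
      then show ?thesis using mixed[of b a] ab by (simp add: mult.commute)
    next
      case 4
      show ?thesis
      proof (cases "a \<in> hall_block n i \<longleftrightarrow> b \<in> hall_block n i")
        case True
        then have "(\<Sum>k<n. ?M $$ (a, k) * ?M $$ (b, k)) = (\<Sum>k<n. N $$ (a, k) * N $$ (b, k))"
          using ab 4 by (intro sum.cong) (simp_all add: M)
        then show ?thesis using orth[OF ab] by simp
      next
        case False
        obtain k l where kl: "k \<in> {1..4}" "a \<in> hall_block n k" "l \<in> {1..4}" "b \<in> hall_block n l"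
          using hall_block_exhaust[OF n] ab 4 by (metis leD)
        then have "k \<noteq> l" using False disj i by blast
        \<comment> \<open>Exactly one of the two rows is negated in the Hall columns, so that part
          must vanish; it does, since distinct block vectors are orthogonal.\<close>
        have "(\<Sum>c<4. N $$ (a, c) * N $$ (b, c))
            = type_sign (3 + k) * type_sign (3 + l) * (\<Sum>c<4. type_vec (3 + k) c * type_vec (3 + l) c)"
          unfolding sum_distrib_left
        proof (intro sum.cong refl)
          fix c :: nat assume "c \<in> {..<4}"
          moreover have "hall_type n a = 3 + k" "hall_type n b = 3 + l"
            using kl hall_type_eq_iff[OF n(2)] by auto
          ultimately show "N $$ (a, c) * N $$ (b, c)
              = type_sign (3 + k) * type_sign (3 + l) * (type_vec (3 + k) c * type_vec (3 + l) c)"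
            using left ab by simp
        qed
        then have zero: "(\<Sum>c<4. N $$ (a, c) * N $$ (b, c)) = 0"
          using type_vec_orthogonal[OF kl(1,3)] \<open>k \<noteq> l\<close> by simp
        have split: "(\<Sum>c<n. f c) = (\<Sum>c<4. f c) + (\<Sum>c=4..<n. f c)" for f :: "nat \<Rightarrow> int"
          using n(2) sum.atLeastLessThan_concat[of 0 4 n f] by (simp add: lessThan_atLeast0)
        have "(\<Sum>c<4. ?M $$ (a, c) * ?M $$ (b, c)) = (\<Sum>c<4. - (N $$ (a, c) * N $$ (b, c)))"
          using ab 4 False n(2) by (intro sum.cong) (auto simp: M)
        moreover have "(\<Sum>c=4..<n. ?M $$ (a, c) * ?M $$ (b, c)) = (\<Sum>c=4..<n. N $$ (a, c) * N $$ (b, c))"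
          using ab 4 by (intro sum.cong) (auto simp: M)
        ultimately show ?thesis
          using zero orth[OF ab] by (simp add: split sum_negf)
      qed
    qed
  qed
  moreover have "?M $$ (r, c) \<in> {1, -1}" if "r < n" "c < n" for r c
  proof -
    have "N $$ (r, c) \<in> {1, -1}" using N(1) that unfolding hadamard_iff_sum by blast
    then show ?thesis using M[OF that] by auto
  qed
  ultimately show ?thesis
    unfolding hadamard_iff_sum by (auto simp: switch_form_def)
qed

subsection \<open>Existence of the block form\<close>

text \<open>The eight type counts satisfy eight linear equations: six from pairs of coordinates, the
  total \<open>n\<close>, and \<open>card4\<close>. Their solution is unique. The vectors
  \<open>w x\<close> are general because the lemma serves first columns and then rows.\<close>

lemma hall_type_count:
  assumes n: "n mod 8 = 4" "n \<ge> 12"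
    and t: "\<And>x. x < n \<Longrightarrow> t x < 8"
    and card4: "card {x. x < n \<and> t x < 4} = 4"
    and w: "\<And>x. x < n \<Longrightarrow> \<exists>s\<in>{1, -1}. \<forall>r<4. s * w x r = type_vec (t x) r"
    and orth: "\<And>r r'. r < 4 \<Longrightarrow> r' < 4 \<Longrightarrow> r \<noteq> r' \<Longrightarrow> (\<Sum>x<n. w x r * w x r') = 0"
    and k: "k < 8"
  shows "card {x. x < n \<and> t x = k} = (if k < 4 then 1 else (n - 4) div 4)"
proof -
  define a where "a k = int (card {x. x < n \<and> t x = k})" for k
  have group: "(\<Sum>x<n. f (t x)) = (\<Sum>k<8. a k * f k)" for f :: "nat \<Rightarrow> int"
  proof -
    have "(\<Sum>x<n. f (t x)) = (\<Sum>k<8. \<Sum>x\<in>{x \<in> {..<n}. t x = k}. f (t x))"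
      using t by (intro sum.group[symmetric]) auto
    also have "\<dots> = (\<Sum>k<8. a k * f k)"
      by (intro sum.cong) (simp_all add: a_def)
    finally show ?thesis .
  qed
  have eq: "(\<Sum>k<8. a k * (type_vec k r * type_vec k r')) = 0" if r: "r < 4" "r' < 4" "r \<noteq> r'" for r r'
  proof -
    \<comment> \<open>The unknown sign occurs twice in a product of two coordinates and
      cancels.\<close>
    have "type_vec (t x) r * type_vec (t x) r' = w x r * w x r'" if "x < n" for x
    proof -
      obtain s where "s \<in> {1, -1}" "\<forall>r<4. s * w x r = type_vec (t x) r"
        using w[OF \<open>x < n\<close>] by blast
      then show ?thesis using r by (metis insertE minus_mult_minus mult_1 mult_minus1 singletonD)
    qed
    then show ?thesis
      using orth[OF r] by (simp flip: group)
  qed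
  have "(\<Sum>k<8. a k) = n"
    using group[of "\<lambda>_. 1"] by simp
  \<comment> \<open>The other seven equations leave one degree of freedom, which the number of Hall
    positions fixes.\<close>
  moreover have "(\<Sum>k<8. a k * (if k < 4 then 1 else 0)) = 4"
  proof -
    have "(\<Sum>x<n. if t x < 4 then 1 else 0 :: int) = int (card {x. x < n \<and> t x < 4})"
      by (simp add: sum.If_cases Int_def)
    then show ?thesis using group[of "\<lambda>k. if k < 4 then 1 else 0"] card4 by simp
  qed
  ultimately have "a 0 = 1 \<and> a 1 = 1 \<and> a 2 = 1 \<and> a 3 = 1 \<and>
      4 * a 4 = int n - 4 \<and> 4 * a 5 = int n - 4 \<and> 4 * a 6 = int n - 4 \<and> 4 * a 7 = int n - 4"
    using eq[of 0 1] eq[of 0 2] eq[of 0 3] eq[of 1 2] eq[of 1 3] eq[of 2 3]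
    by (simp add: sum_less_8 type_vec_def hall_vec_simps)
  then have "a k = (if k < 4 then 1 else (int n - 4) div 4)"
    using less_8_cases[OF k] by auto
  then show ?thesis
    using n unfolding a_def by (auto split: if_splits)
qed

text \<open>Two labellings of a finite set with equal fibre sizes have the same multiset of labels
  and so differ by a permutation.\<close>

lemma hall_type_permutation:
  assumes n: "n mod 8 = 4" "n \<ge> 12"
    and t: "\<And>x. x < n \<Longrightarrow> t x < 8"
    and count: "\<And>k. k < 8 \<Longrightarrow> card {x. x < n \<and> t x = k} = (if k < 4 then 1 else (n - 4) div 4)"
  obtains p where "p permutes {..<n}" "\<And>j. j < n \<Longrightarrow> t (p j) = hall_type n j"
proof -
  have hall_count: "card {x. x < n \<and> hall_type n x = k} = (if k < 4 then 1 else (n - 4) div 4)" if "k < 8" for k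
  proof (cases "k < 4")
    case True
    then have "{x. x < n \<and> hall_type n x = k} = {k}"
      using n by (auto simp: hall_type_def split: if_splits)
    then show ?thesis using True by simp
  next
    case False
    then have k: "k - 3 \<in> {1..4}" "3 + (k - 3) = k" using that by auto
    then have "{x. x < n \<and> hall_type n x = k} = hall_block n (k - 3)"
      using hall_type_eq_iff[OF n(2) k(1)] hall_block_bounds[OF n(1) k(1)] by auto
    then show ?thesis using False by (simp add: card_hall_block)
  qed
  have count_card: "count (image_mset f (mset_set {..<n})) k = card {x. x < n \<and> f x = k}" for f :: "nat \<Rightarrow> nat" and k
    by (simp add: count_image_mset' eq_commute[of k])
  have "image_mset (hall_type n) (mset_set {..<n}) = image_mset t (mset_set {..<n})"
  proof (rule multiset_eqI)
    fix k
    show "count (image_mset (hall_type n) (mset_set {..<n})) k = count (image_mset t (mset_set {..<n})) k"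
    proof (cases "k < 8")
      case True
      then show ?thesis by (simp only: count_card hall_count count)
    next
      case False
      then have "{x. x < n \<and> hall_type n x = k} = {}" "{x. x < n \<and> t x = k} = {}"
        using t hall_type_less_8[OF n(1)] by auto
      then show ?thesis by (simp only: count_card)
    qed
  qed
  then obtain p where "p permutes {..<n}" "\<forall>x\<in>{..<n}. hall_type n x = t (p x)"
    using image_mset_eq_implies_permutes by blast
  then show ?thesis using that by simp
qed

text \<open>The 16 sign vectors of length 4 form 8 pairs up to negation, one for each type. Negation
  preserves the product of four signs, which is -1 for the columns of \<open>H_4\<close> and 1 for
  the block vectors.\<close>

lemma ex_hall_type:
  fixes a :: "nat \<Rightarrow> int"
  assumes "\<And>r. r < 4 \<Longrightarrow> a r \<in> {1, -1}"
  shows "\<exists>t<8. \<exists>s\<in>{1, -1}. (\<forall>r<4. s * a r = type_vec t r) \<and> (t < 4 \<longleftrightarrow> a 0 * a 1 * a 2 * a 3 = -1)"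
proof -
  have "a 0 = 1 \<or> a 0 = -1" "a 1 = 1 \<or> a 1 = -1" "a 2 = 1 \<or> a 2 = -1" "a 3 = 1 \<or> a 3 = -1"
    using assms[of 0] assms[of 1] assms[of 2] assms[of 3] by auto
  then show ?thesis
    unfolding ex_less_8 all_less_4
    by (elim disjE) (simp_all add: type_vec_def hall_vec_simps)
qed

lemma even_sum_signs:
  fixes f :: "'a \<Rightarrow> int"
  assumes "finite A" "even (card A)" "\<And>x. x \<in> A \<Longrightarrow> f x \<in> {1, -1}"
  shows "even (sum f A)"
proof -
  have "even (sum f A) \<longleftrightarrow> even (card {x \<in> A. odd (f x)})"
    using assms(1) by (rule even_sum_iff)
  moreover have "{x \<in> A. odd (f x)} = A" using assms(3) by fastforce
  ultimately show ?thesis using assms(2) by simp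
qed

text \<open>With \<open>m\<close> negative signs the sum is \<open>4 - 2 * m\<close>, so
  \<open>k = 2 - m\<close>, and \<open>k\<close> has the parity of \<open>m\<close>.\<close>

lemma product_of_signs_eq_1:
  fixes a b c d k :: int
  assumes "2 * k = a + b + c + d" "even k"
    and "a = 1 \<or> a = -1" "b = 1 \<or> b = -1" "c = 1 \<or> c = -1" "d = 1 \<or> d = -1"
  shows "a * b * c * d = 1"
  using assms(3-) assms(1,2) by (elim disjE; simp; presburger)

text \<open>Columns are arranged first, by their entries in the Hall rows; then rows, by their
  entries in the Hall columns. The parity argument for rows already uses the first block of
  columns.\<close>

lemma ex_hall_form:
  assumes n: "n mod 8 = 4" "n \<ge> 12" and H: "hadamard n H"
    and R: "R \<subseteq> {..<n}" "card R = 4" and C: "hall_columns n H R C"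
  obtains p e q d where "signed_perm n p e" "signed_perm n q d" "p ` {..<4} = R" "q ` {..<4} = C"
    "hall_form n (apply_signed_perms n p e q d H)"
proof -
  have pm: "H $$ (x, j) \<in> {1, -1}" if "x < n" "j < n" for x j
    using H that unfolding hadamard_iff_sum by blast
  have orth: "(\<Sum>j<n. H $$ (x, j) * H $$ (y, j)) = 0" if "x < n" "y < n" "x \<noteq> y" for x y
    using H that unfolding hadamard_iff_sum by blast
  obtain s where s: "s \<in> {1, -1}" and C_eq: "C = {j. j < n \<and> (\<Prod>x\<in>R. H $$ (x, j)) = s}"
    and card_C: "card C = 4"
    using C unfolding hall_columns_def by blast
  have finR: "finite R" using R(1) finite_subset by blast
  obtain \<rho> :: "nat \<Rightarrow> nat" where \<rho>: "bij_betw \<rho> {..<4} R"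
    using ex_bij_betw_nat_finite[OF finR] R(2) by (metis lessThan_atLeast0)
  have \<rho>R: "\<rho> k \<in> R" "\<rho> k < n" if "k < 4" for k
    using \<rho> R(1) that by (auto simp: bij_betw_def)
  have \<rho>_inj: "\<rho> k = \<rho> l \<longleftrightarrow> k = l" if "k < 4" "l < 4" for k l
    using \<rho> that by (auto simp: bij_betw_def inj_on_def)
  \<comment> \<open>Scaling one Hall row by \<open>- s\<close> makes the product -1 exactly on the
    Hall columns, as it is in the columns of \<open>H_4\<close>.\<close>
  define \<eta> :: "nat \<Rightarrow> int" where "\<eta> k = (if k = 0 then - s else 1)" for k
  have \<eta>: "\<eta> k = 1 \<or> \<eta> k = -1" for k using s by (auto simp: \<eta>_def)
  define a where "a j k = \<eta> k * H $$ (\<rho> k, j)" for j k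
  have a_pm: "a j k \<in> {1, -1}" if "k < 4" "j < n" for j k
    using \<eta>[of k] pm[OF \<rho>R(2)[OF that(1)] that(2)] by (auto simp: a_def)
  have in_C: "j \<in> C \<longleftrightarrow> a j 0 * a j 1 * a j 2 * a j 3 = -1" if "j < n" for j
  proof -
    have "(\<Prod>x\<in>R. H $$ (x, j)) = (\<Prod>k<4. H $$ (\<rho> k, j))"
      using prod.reindex_bij_betw[OF \<rho>, of "\<lambda>x. H $$ (x, j)"] by simp
    also have "\<dots> = H $$ (\<rho> 0, j) * H $$ (\<rho> 1, j) * H $$ (\<rho> 2, j) * H $$ (\<rho> 3, j)"
      by (simp add: eval_nat_numeral)
    finally have "a j 0 * a j 1 * a j 2 * a j 3 = - s * (\<Prod>x\<in>R. H $$ (x, j))"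
      by (simp add: a_def \<eta>_def)
    then show ?thesis using s that by (auto simp: C_eq)
  qed
  have "\<exists>t s. t < 8 \<and> s \<in> {1, -1} \<and> (\<forall>r<4. s * a j r = type_vec t r) \<and> (t < 4 \<longleftrightarrow> j \<in> C)"
    if "j < n" for j
    using ex_hall_type[of "a j", OF a_pm[OF _ that]] unfolding in_C[OF that] by blast
  then obtain t \<sigma> where t: "\<And>j. j < n \<Longrightarrow> t j < 8" and \<sigma>: "\<And>j. j < n \<Longrightarrow> \<sigma> j \<in> {1, -1}"
    and t_vec: "\<And>j r. j < n \<Longrightarrow> r < 4 \<Longrightarrow> \<sigma> j * a j r = type_vec (t j) r"
    and t_C: "\<And>j. j < n \<Longrightarrow> t j < 4 \<longleftrightarrow> j \<in> C"
    by metis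
  have "{x. x < n \<and> t x < 4} = C" using t_C C_eq by auto
  then have "card {x. x < n \<and> t x < 4} = 4" using card_C by simp
  moreover have "(\<Sum>j<n. a j r * a j r') = 0" if "r < 4" "r' < 4" "r \<noteq> r'" for r r'
  proof -
    have "(\<Sum>j<n. a j r * a j r') = \<eta> r * \<eta> r' * (\<Sum>j<n. H $$ (\<rho> r, j) * H $$ (\<rho> r', j))"
      by (simp add: a_def sum_distrib_left mult_ac)
    then show ?thesis using orth[of "\<rho> r" "\<rho> r'"] \<rho>R \<rho>_inj that by simp
  qed
  moreover have "\<exists>s\<in>{1, -1}. \<forall>r<4. s * a j r = type_vec (t j) r" if "j < n" for j
    using t_vec \<sigma> that by blast
  ultimately have "card {x. x < n \<and> t x = k} = (if k < 4 then 1 else (n - 4) div 4)" if "k < 8" for k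
    using hall_type_count[where t = t and w = a, OF n t] that by blast
  then obtain q where q: "q permutes {..<n}" and tq: "\<And>j. j < n \<Longrightarrow> t (q j) = hall_type n j"
    using hall_type_permutation[where t = t, OF n t] by blast
  have qn: "q j < n" if "j < n" for j
    using permutes_in_image[OF q, of j] that by simp
  define d where "d j = \<sigma> (q j)" for j
  have d: "d j = 1 \<or> d j = -1" if "j < n" for j
    using \<sigma>[OF qn[OF that]] by (simp add: d_def)
  \<comment> \<open>Positions below 4 receive columns of type below 4; equality follows since both
    sets have four elements.\<close>
  have "q ` {..<4} \<subseteq> C"
  proof
    fix x assume "x \<in> q ` {..<4}"
    then obtain j where j: "j < 4" "x = q j" by auto
    moreover from this have "j < n" using n(2) by simp
    ultimately show "x \<in> C"
      using t_C[OF qn, of j] tq[of j] by (simp add: hall_type_def)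
  qed
  then have qC: "q ` {..<4} = C"
    using card_C card_image[OF permutes_inj_on[OF q], of "{..<4}"]
    by (intro card_subset_eq) (auto simp: C_eq)

  \<comment> \<open>The matrix after the column operations, with its rows still in the original
    order.\<close>
  define y where "y x j = d j * H $$ (x, q j)" for x j
  have y_pm: "y x j \<in> {1, -1}" if "x < n" "j < n" for x j
    using pm[OF that(1) qn[OF that(2)]] d[OF that(2)] by (auto simp: y_def)
  have y_hall: "\<eta> k * y (\<rho> k) j = type_vec (hall_type n j) k" if "k < 4" "j < n" for k j
    using t_vec[OF qn[OF that(2)] that(1)] tq[OF that(2)] by (simp add: y_def d_def a_def mult_ac)
  have y_orth: "(\<Sum>j<n. y x j * y x' j) = 0" if "x < n" "x' < n" "x \<noteq> x'" for x x'
  proof -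
    have "(\<Sum>j<n. y x j * y x' j) = (\<Sum>j<n. H $$ (x, q j) * H $$ (x', q j))"
      using d by (intro sum.cong) (force simp: y_def)+
    also have "\<dots> = (\<Sum>j<n. H $$ (x, j) * H $$ (x', j))"
      using sum.permute[OF q, of "\<lambda>j. H $$ (x, j) * H $$ (x', j)"] by (simp add: o_def)
    finally show ?thesis using orth[OF that] by simp
  qed
  have y_col_orth: "(\<Sum>x<n. y x r * y x r') = 0" if "r < 4" "r' < 4" "r \<noteq> r'" for r r'
  proof -
    have "(\<Sum>x<n. y x r * y x r') = d r * d r' * (\<Sum>x<n. H $$ (x, q r) * H $$ (x, q r'))"
      by (simp add: y_def sum_distrib_left mult_ac)
    moreover have "q r \<noteq> q r'" using that permutes_inj[OF q] by (auto dest: injD)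
    ultimately show ?thesis
      using hadamard_columns_orthogonal[OF H, of "q r" "q r'"] qn that n(2) by simp
  qed
  have y_prod: "y x 0 * y x 1 * y x 2 * y x 3 = 1" if x: "x < n" "x \<notin> R" for x
  proof -
    have "(\<Sum>j<n. type_vec (hall_type n j) r * y x j) = 0" if "r < 4" for r
    proof -
      have "(\<Sum>j<n. type_vec (hall_type n j) r * y x j) = \<eta> r * (\<Sum>j<n. y (\<rho> r) j * y x j)"
        using that by (simp add: y_hall[symmetric] sum_distrib_left mult_ac)
      moreover have "\<rho> r \<noteq> x" using \<rho>R that x by auto
      ultimately show ?thesis using y_orth[of "\<rho> r" x] \<rho>R that x by simp
    qed
    from hall_block_sum_solution[OF n, of 1, OF _ this]
    \<comment> \<open>Since \<open>f_1\<close> is the all-ones vector and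
      \<open>type_sign 4 = 1\<close>, the first block gives the plain sum of the four
      entries.\<close>
    have "2 * sum (y x) (hall_block n 1) = y x 0 + y x 1 + y x 2 + y x 3"
      by (simp add: type_sign_def type_vec_def sum_less_4 hall_vec_simps)
    moreover have "even (sum (y x) (hall_block n 1))"
    proof (rule even_sum_signs)
      show "finite (hall_block n 1)" by (simp add: hall_block_def)
      have "even ((n - 4) div 4)" using n(1) by presburger
      then show "even (card (hall_block n 1))" by (simp add: card_hall_block)
      show "y x j \<in> {1, -1}" if "j \<in> hall_block n 1" for j
        using y_pm[OF x(1)] hall_block_bounds[OF n(1) _ that] by simp
    qed
    moreover have "y x 0 = 1 \<or> y x 0 = -1" "y x 1 = 1 \<or> y x 1 = -1" "y x 2 = 1 \<or> y x 2 = -1" "y x 3 = 1 \<or> y x 3 = -1"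
      using y_pm[OF x(1), of 0] y_pm[OF x(1), of 1] y_pm[OF x(1), of 2] y_pm[OF x(1), of 3] n(2) by auto
    ultimately show ?thesis by (intro product_of_signs_eq_1)
  qed
  \<comment> \<open>For Hall rows the type and sign are pinned to \<open>\<rho>\<close> and
    \<open>\<eta>\<close>, because the column stage was built on that order and those signs.\<close>
  define P where "P x t s \<longleftrightarrow> t < 8 \<and> s \<in> {1, -1} \<and> (\<forall>c<4. s * y x c = type_vec t c)
      \<and> (t < 4 \<longleftrightarrow> x \<in> R) \<and> (x \<in> R \<longrightarrow> x = \<rho> t \<and> s = \<eta> t)" for x t s
  have "\<exists>t s. P x t s" if "x < n" for x
  proof (cases "x \<in> R")
    case True
    then obtain k where k: "k < 4" "x = \<rho> k" using \<rho> by (auto simp: bij_betw_def)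
    have "\<eta> k * y x c = type_vec k c" if "c < 4" for c
      using y_hall[OF k(1), of c] that n(2) k by (auto simp: hall_type_def type_vec_def)
    then show ?thesis using k True \<eta>[of k] by (intro exI[of _ k] exI[of _ "\<eta> k"]) (auto simp: P_def)
  next
    case False
    have "y x r \<in> {1, -1}" if "r < 4" for r
      using y_pm[OF \<open>x < n\<close>, of r] that n(2) by simp
    from ex_hall_type[of "y x", OF this] obtain t s where "t < 8" "s \<in> {1, -1}"
      "\<forall>r<4. s * y x r = type_vec t r" "t < 4 \<longleftrightarrow> y x 0 * y x 1 * y x 2 * y x 3 = -1"
      by blast
    then show ?thesis
      using y_prod[OF that False] False by (intro exI[of _ t] exI[of _ s]) (simp add: P_def)
  qed
  then obtain u \<tau> where "\<And>x. x < n \<Longrightarrow> P x (u x) (\<tau> x)"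
    by metis
  then have u: "\<And>x. x < n \<Longrightarrow> u x < 8" and \<tau>: "\<And>x. x < n \<Longrightarrow> \<tau> x \<in> {1, -1}"
    and u_vec: "\<And>x c. x < n \<Longrightarrow> c < 4 \<Longrightarrow> \<tau> x * y x c = type_vec (u x) c"
    and u_R: "\<And>x. x < n \<Longrightarrow> u x < 4 \<longleftrightarrow> x \<in> R"
    and u_\<rho>: "\<And>x. x < n \<Longrightarrow> x \<in> R \<Longrightarrow> x = \<rho> (u x) \<and> \<tau> x = \<eta> (u x)"
    unfolding P_def by blast+
  have "{x. x < n \<and> u x < 4} = R" using u_R R(1) by auto
  then have "card {x. x < n \<and> u x < 4} = 4" using R(2) by simp
  moreover have "\<exists>s\<in>{1, -1}. \<forall>r<4. s * y x r = type_vec (u x) r" if "x < n" for x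
    using u_vec \<tau> that by blast
  ultimately have "card {x. x < n \<and> u x = k} = (if k < 4 then 1 else (n - 4) div 4)" if "k < 8" for k
    using hall_type_count[where t = u and w = y, OF n u] y_col_orth that by blast
  then obtain p where p: "p permutes {..<n}" and up: "\<And>j. j < n \<Longrightarrow> u (p j) = hall_type n j"
    using hall_type_permutation[where t = u, OF n u] by blast
  have pn: "p j < n" if "j < n" for j
    using permutes_in_image[OF p, of j] that by simp
  have pR: "p j \<in> R" "p j = \<rho> j" "\<tau> (p j) = \<eta> j" if "j < 4" for j
  proof -
    have "j < n" using that n(2) by simp
    moreover have "u (p j) = j" using up[OF \<open>j < n\<close>] that by (simp add: hall_type_def)
    ultimately show "p j \<in> R" "p j = \<rho> j" "\<tau> (p j) = \<eta> j"
      using u_R[OF pn, of j] u_\<rho>[OF pn, of j] that by metis+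
  qed
  have p_image: "p ` {..<4} = R"
    using pR(2) \<rho> by (auto simp: bij_betw_def image_def)
  \<comment> \<open>The factor \<open>type_sign\<close> produces the minus sign in
    \<open>G_i = - F_i^T\<close> for \<open>i\<close> from 2 to 4.\<close>
  define e where "e j = type_sign (hall_type n j) * \<tau> (p j)" for j
  let ?N = "apply_signed_perms n p e q d H"
  have N: "?N $$ (r, c) = e r * y (p r) c" if "r < n" "c < n" for r c
    using that by (simp add: apply_signed_perms_def y_def)
  have sp: "signed_perm n p e"
    using p \<tau>[OF pn] by (auto simp: signed_perm_def e_def type_sign_def)
  have sq: "signed_perm n q d"
    using q d by (auto simp: signed_perm_def)
  have "hadamard n ?N"
    using hadamard_apply_signed_perms[OF sp sq H] .
  moreover have "?N $$ (r, c) = type_vec (hall_type n c) r" if "r < 4" "c < n" for r c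
    using N[of r c] that n(2) pR[OF that(1)] y_hall[OF that]
    by (simp add: e_def hall_type_def[of n r] type_sign_def)
  moreover have "?N $$ (r, c) = type_sign (hall_type n r) * type_vec (hall_type n r) c" if "r < n" "c < 4" for r c
    using N[of r c] that n(2) u_vec[OF pn[OF that(1)] that(2)] up[OF that(1)]
    by (simp add: e_def mult.assoc)
  ultimately have "hall_form n ?N"
    using hall_border_imp_hall_form[OF n] unfolding hall_border_def by blast
  then show ?thesis using that sp sq p_image qC by blast
qed

subsection \<open>Switching a Hall set\<close>

theorem proposition3p4:
  fixes n i :: nat and H :: "int mat" and R :: "nat set"
  assumes "n mod 8 = 4" and "n \<ge> 12"
    and "hadamard n H"
    and "hall_set n H R"
    and "i \<in> {1..4}"
  shows "(\<exists>H'. hall_switching n H R i H') \<and>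
         (\<forall>H'. hall_switching n H R i H' \<longrightarrow> hadamard n H')"
proof (intro conjI allI impI)
  obtain C where R: "R \<subseteq> {..<n}" "card R = 4" and C: "hall_columns n H R C"
    using assms(4) unfolding hall_set_def by blast
  \<comment> \<open>As switching is a relation, the existence of a block form is what keeps the
    second claim from being vacuous.\<close>
  show "\<exists>H'. hall_switching n H R i H'"
    using ex_hall_form[OF assms(1-3) R C] C unfolding hall_switching_def by metis
next
  fix H' assume "hall_switching n H R i H'"
  \<comment> \<open>Normalising, switching and undoing the normalisation each preserve the Hadamard
    property, whichever block form was chosen.\<close>
  then show "hadamard n H'"
    unfolding hall_switching_def
    using hadamard_switch_form[OF assms(1,2,5)] hadamard_apply_signed_perms signed_perm_inv assms(3)
    by blast
qed

end
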